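(* Let $d\ge2$, let $\kappa=(\kappa_1,\dots,\kappa_d)$ with all $\kappa_i\ge0$, let $0\le m\le n$ and $1\le\ell\le a_m^d$. Then, for $(x,t)\in\mathbb{V}_0^{d+1}$, $$\lim_{\gamma\to\infty}\gamma^m\,\mathsf{J}_{m,\ell}^n\Big(\frac x\gamma,\frac t\gamma\Big)=\mathsf{L}_{m,\ell}^n(x,t)\qquad\text{and}\qquad\lim_{\gamma\to\infty}\gamma^{2m}\,\mathsf{h}^{\mathsf{J}}_{m,n}=\mathsf{h}_{m,n}.$$ Furthermore, for the reproducing kernels and all $(x,t),(y,s)\in\mathbb{V}_0^{d+1}$, $$\lim_{\gamma\to\infty}\mathsf{P}_n^{\mathsf{J}}\Big(\mathsf{w}_{\kappa,\gamma};\Big(\frac x\gamma,\frac t\gamma\Big),\Big(\frac y\gamma,\frac s\gamma\Big)\Big)=\mathsf{P}_n(\mathsf{w}_\kappa;(x,t),(y,s)).$$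
   Context: Notation: $|\kappa|=\kappa_1+\dots+\kappa_d$, $h_\kappa(x)=\prod_{i=1}^d|x_i|^{\kappa_i}$. The conic surface is $\mathbb{V}_0^{d+1}=\{(x,t)\in\mathbb{R}^d\times[0,\infty):\|x\|=t\}$ with measure $\sigma$ given by $\int_{\mathbb{V}_0^{d+1}}f\,d\sigma=\int_0^\infty t^{d-1}\int_{\mathbb{S}^{d-1}}f(t\xi,t)\,d\sigma_{\mathbb{S}}(\xi)\,dt$, where $d\sigma_{\mathbb S}$ is the surface measure of $\mathbb{S}^{d-1}$. Let $\mathcal{H}_m^d(h_\kappa^2)$ be the space of $h$-harmonics of degree $m$: homogeneous polynomials of degree $m$ in $d$ variables orthogonal to all polynomials of lower degree with respect to $h_\kappa^2\,d\sigma_{\mathbb S}$ on $\mathbb{S}^{d-1}$; its dimension is $a_m^d=\binom{m+d-1}{m}-\binom{m+d-3}{m-2}$. Let $\{Y_\ell^m:1\le\ell\le a_m^d\}$ be a basis of it, orthonormal with respect to the measure $h_\kappa^2\,d\sigma_{\mathbb{S}}$ normalized to total mass $1$ on $\mathbb{S}^{d-1}$. Laguerre case: $\mathsf{w}_\kappa(x,t)=h_\kappa^2(x)t^{-1}e^{-t}$, $\mathsf{L}_{m,\ell}^n(x,t)=L_{n-m}^{2m+2|\kappa|+d-2}(t)Y_\ell^m(x)$, with $L_n^\alpha$ the Laguerre polynomial ($\sum_nL_n^\alpha(t)r^n=(1-r)^{-\alpha-1}e^{-tr/(1-r)}$). Jacobi case, $\gamma>-1$: $\mathsf{w}_{\kappa,\gamma}(x,t)=h_\kappa^2(x)t^{-1}(1-t)_+^\gamma$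 (zero for $t\ge1$), $\mathsf{J}_{m,\ell}^n(x,t)=P_{n-m}^{(2m+2|\kappa|+d-2,\gamma)}(1-2t)Y_\ell^m(x)$, with $P_n^{(\alpha,\beta)}$ the standard Jacobi polynomial. For either weight $w$, use the inner product $\langle f,g\rangle=b\int_{\mathbb{V}_0^{d+1}}fg\,w\,d\sigma$ normalized by $\langle1,1\rangle=1$. The families $\{\mathsf{L}^n_{m,\ell}\}$, $\{\mathsf{J}^n_{m,\ell}\}$ ($0\le m\le n$, $1\le\ell\le a_m^d$) are orthogonal bases of the corresponding spaces of orthogonal polynomials of degree $n$, with squared norms $\mathsf{h}_{m,n}=\langle\mathsf{L}^n_{m,\ell},\mathsf{L}^n_{m,\ell}\rangle$ and $\mathsf{h}^{\mathsf J}_{m,n}=\langle\mathsf{J}^n_{m,\ell},\mathsf{J}^n_{m,\ell}\rangle$ (independent of $\ell$). The reproducing kernels are $\mathsf{P}_n(\mathsf{w}_\kappa;(x,t),(y,s))=\sum_{m=0}^n\sum_{\ell=1}^{a_m^d}\mathsf{L}^n_{m,\ell}(x,t)\mathsf{L}^n_{m,\ell}(y,s)/\mathsf{h}_{m,n}$ and $\mathsf{P}^{\mathsf J}_n(\mathsf{w}_{\kappa,\gamma};(x,t),(y,s))=\sum_{m=0}^n\sum_{\ell=1}^{a_m^d}\mathsf{J}^n_{m,\ell}(x,t)\mathsf{J}^n_{m,\ell}(y,s)/\mathsf{h}^{\mathsf J}_{m,n}$. *)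

theory Defs
  imports "HOL-Analysis.Analysis"
begin

section \<open>Measures on the unit sphere and on the conic surface\<close>

text \<open>
  Surface measure of the unit sphere, as a Borel measure on the ambient space concentrated on
  \<open>sphere 0 1\<close>: the measure of a set of directions is \<open>d\<close> times the Lebesgue volume of the part
  of the unit ball lying in these directions (\<open>sgn x = x /\<^sub>R norm x\<close>).
\<close>

definition sphere_measure :: "(real ^ 'd) measure" where
  "sphere_measure =
     scale_measure (of_nat CARD('d)) (distr (restrict_space lborel (ball 0 1 - {0})) borel sgn)"

definition cone_surface :: "((real ^ 'd) \<times> real) set" where
  "cone_surface = {(x, t). 0 \<le> t \<and> norm x = t}"

text \<open>
  The image of \<open>t\<^sup>d\<^sup>-\<^sup>1 dt d\<sigma>(\<xi>)\<close> under \<open>(t, \<xi>) \<mapsto> (t \<xi>, t)\<close>; the resulting integration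
  formula is \<open>nn_integral_cone_measure\<close> below.
\<close>

definition cone_measure :: "((real ^ 'd) \<times> real) measure" where
  "cone_measure =
     distr (density lborel (\<lambda>t. ennreal (indicator {0..} t * t ^ (CARD('d) - 1)))
              \<Otimes>\<^sub>M (sphere_measure :: (real ^ 'd) measure))
           borel (\<lambda>(t, \<xi>). (t *\<^sub>R \<xi>, t))"

lemma space_sphere_measure [simp]: "space sphere_measure = UNIV"
  and sets_sphere_measure [measurable_cong, simp]: "sets sphere_measure = sets borel"
  by (simp_all add: sphere_measure_def space_scale_measure)

lemma measurable_sgn_borel [measurable]:
  "(sgn :: real ^ 'd \<Rightarrow> real ^ 'd) \<in> borel_measurable borel"
  unfolding sgn_div_norm[abs_def] by measurable

lemma emeasure_sphere_measure:
  assumes A: "A \<in> sets borel"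
  shows "emeasure (sphere_measure :: (real ^ 'd) measure) A =
    of_nat CARD('d) * emeasure lborel {x \<in> ball 0 1 - {0}. sgn x \<in> A}"
proof -
  let ?B = "ball 0 1 - {0} :: (real ^ 'd) set"
  have B: "?B \<in> sets borel" by auto
  have m: "sgn \<in> measurable (restrict_space lborel ?B) (borel :: (real ^ 'd) measure)"
    by (rule measurable_restrict_space1) simp
  have *: "sgn -` A \<inter> ?B = {x \<in> ?B. sgn x \<in> A}" by auto
  have "emeasure (distr (restrict_space lborel ?B) borel sgn) A =
      emeasure (restrict_space lborel ?B) {x \<in> ?B. sgn x \<in> A}"
    using A m * by (simp add: emeasure_distr space_restrict_space del: Diff_iff mem_ball)
  also have "\<dots> = emeasure lborel {x \<in> ?B. sgn x \<in> A}"
    using B by (intro emeasure_restrict_space) auto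
  finally show ?thesis
    by (simp add: sphere_measure_def)
qed

lemma emeasure_sphere_measure_sphere:
  "emeasure (sphere_measure :: (real ^ 'd) measure) (sphere 0 1) =
     of_nat CARD('d) * ennreal (unit_ball_vol (real CARD('d)))"
proof -
  have "{x \<in> ball 0 1 - {0} :: (real ^ 'd) set. sgn x \<in> sphere 0 1} = ball 0 1 - {0}"
    by (auto simp: norm_sgn)
  moreover have "emeasure lborel (ball 0 1 - {0} :: (real ^ 'd) set) = emeasure lborel (ball 0 1 :: (real ^ 'd) set)"
    by (rule emeasure_Diff_null_set) auto
  ultimately show ?thesis
    by (simp add: emeasure_sphere_measure emeasure_ball)
qed

lemma finite_sphere_measure: "finite_measure (sphere_measure :: (real ^ 'd) measure)"
proof
  have "emeasure lborel (ball 0 1 - {0} :: (real ^ 'd) set) \<le> emeasure lborel (ball 0 1 :: (real ^ 'd) set)"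
    by (rule emeasure_mono) auto
  also have "\<dots> < top" by (simp add: emeasure_ball)
  finally have "emeasure lborel (ball 0 1 - {0} :: (real ^ 'd) set) < top" .
  then show "emeasure (sphere_measure :: (real ^ 'd) measure) (space sphere_measure) \<noteq> \<infinity>"
    by (auto simp: emeasure_sphere_measure ennreal_mult_eq_top_iff set_diff_eq)
qed

lemma nn_integral_cone_measure:
  assumes f: "f \<in> borel_measurable borel"
  shows "(\<integral>\<^sup>+ z. f z \<partial>(cone_measure :: ((real ^ 'd) \<times> real) measure)) =
    (\<integral>\<^sup>+ t. ennreal (indicator {0..} t * t ^ (CARD('d) - 1)) *
       (\<integral>\<^sup>+ \<xi>. f (t *\<^sub>R \<xi>, t) \<partial>sphere_measure) \<partial>lborel)"
proof -
  interpret finite_measure "sphere_measure :: (real ^ 'd) measure"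
    by (rule finite_sphere_measure)
  note f [measurable]
  let ?D = "density lborel (\<lambda>t. ennreal (indicator {0..} t * t ^ (CARD('d) - 1)))"
  have m [measurable]: "(\<lambda>(t, \<xi>). (t *\<^sub>R \<xi>, t)) \<in>
      ?D \<Otimes>\<^sub>M (sphere_measure :: (real ^ 'd) measure) \<rightarrow>\<^sub>M borel"
    by (simp add: borel_prod [symmetric]) measurable
  have g: "(\<lambda>z. f (fst z *\<^sub>R snd z, fst z)) \<in>
      borel_measurable (?D \<Otimes>\<^sub>M (sphere_measure :: (real ^ 'd) measure))"
    using measurable_compose[OF m f] by (simp add: case_prod_beta)
  have g': "(\<lambda>z. f (fst z *\<^sub>R snd z, fst z)) \<in>
      borel_measurable (lborel \<Otimes>\<^sub>M (sphere_measure :: (real ^ 'd) measure))"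
    using g by (simp cong: measurable_cong_sets sets_pair_measure_cong)
  have h: "(\<lambda>t. \<integral>\<^sup>+ \<xi>. f (t *\<^sub>R \<xi>, t) \<partial>(sphere_measure :: (real ^ 'd) measure))
      \<in> borel_measurable lborel"
    using borel_measurable_nn_integral_fst[OF g'] by simp
  have "(\<integral>\<^sup>+ z. f z \<partial>(cone_measure :: ((real ^ 'd) \<times> real) measure)) =
      (\<integral>\<^sup>+ z. f (fst z *\<^sub>R snd z, fst z) \<partial>(?D \<Otimes>\<^sub>M sphere_measure))"
    unfolding cone_measure_def by (subst nn_integral_distr[OF m]) (simp_all add: case_prod_beta f)
  also have "\<dots> = (\<integral>\<^sup>+ t. (\<integral>\<^sup>+ \<xi>. f (t *\<^sub>R \<xi>, t) \<partial>sphere_measure) \<partial>?D)"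
    using nn_integral_fst[OF g] by simp
  also have "\<dots> = (\<integral>\<^sup>+ t. ennreal (indicator {0..} t * t ^ (CARD('d) - 1)) *
       (\<integral>\<^sup>+ \<xi>. f (t *\<^sub>R \<xi>, t) \<partial>sphere_measure) \<partial>lborel)"
    using h by (subst nn_integral_density) auto
  finally show ?thesis .
qed

section \<open>The weight and its \<open>h\<close>-harmonics\<close>

definition abs_kappa :: "real ^ 'd \<Rightarrow> real" where
  "abs_kappa \<kappa> = (\<Sum>i\<in>UNIV. \<kappa> $ i)"

text \<open>The case distinction is needed because \<open>0 powr 0 = 0\<close>, whereas the factor is 1 for \<open>\<kappa>\<^sub>i = 0\<close>.\<close>

definition h_weight :: "real ^ 'd \<Rightarrow> real ^ 'd \<Rightarrow> real" where
  "h_weight \<kappa> x = (\<Prod>i\<in>UNIV. if \<kappa> $ i = 0 then 1 else \<bar>x $ i\<bar> powr (\<kappa> $ i))"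

definition monomial :: "('d \<Rightarrow> nat) \<Rightarrow> real ^ 'd \<Rightarrow> real" where
  "monomial a x = (\<Prod>i\<in>UNIV. (x $ i) ^ a i)"

definition homogeneous_polys :: "nat \<Rightarrow> (real ^ 'd \<Rightarrow> real) set" where
  "homogeneous_polys m =
     {p. \<exists>c. p = (\<lambda>x. \<Sum>a | (\<Sum>i\<in>UNIV. a i) = m. c a * monomial a x)}"

definition polys_below :: "nat \<Rightarrow> (real ^ 'd \<Rightarrow> real) set" where
  "polys_below m =
     {p. \<exists>c. p = (\<lambda>x. \<Sum>a | (\<Sum>i\<in>UNIV. a i) < m. c a * monomial a x)}"

definition h_harmonics :: "real ^ 'd \<Rightarrow> nat \<Rightarrow> (real ^ 'd \<Rightarrow> real) set" where
  "h_harmonics \<kappa> m = {p \<in> homogeneous_polys m.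
     \<forall>q \<in> polys_below m. (LINT \<xi>|sphere_measure. p \<xi> * q \<xi> * (h_weight \<kappa> \<xi>)\<^sup>2) = 0}"

definition h_dim :: "nat \<Rightarrow> nat \<Rightarrow> nat" where
  "h_dim d m = ((m + d - 1) choose m) - (if m < 2 then 0 else (m + d - 3) choose (m - 2))"

definition sphere_inner ::
  "real ^ 'd \<Rightarrow> (real ^ 'd \<Rightarrow> real) \<Rightarrow> (real ^ 'd \<Rightarrow> real) \<Rightarrow> real" where
  "sphere_inner \<kappa> f g = (LINT \<xi>|sphere_measure. f \<xi> * g \<xi> * (h_weight \<kappa> \<xi>)\<^sup>2) /
     (LINT \<xi>|sphere_measure. (h_weight \<kappa> \<xi>)\<^sup>2)"

text \<open>\<open>Y 1, \<dots>, Y (h_dim d m)\<close> is an orthonormal basis of the \<open>h\<close>-harmonics of degree \<open>m\<close>.\<close>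

definition orthonormal_h_basis ::
  "real ^ 'd \<Rightarrow> nat \<Rightarrow> (nat \<Rightarrow> real ^ 'd \<Rightarrow> real) \<Rightarrow> bool" where
  "orthonormal_h_basis \<kappa> m Y \<longleftrightarrow>
     (\<forall>l \<in> {1..h_dim CARD('d) m}. Y l \<in> h_harmonics \<kappa> m) \<and>
     (\<forall>p \<in> h_harmonics \<kappa> m. \<exists>c. p = (\<lambda>x. \<Sum>l = 1..h_dim CARD('d) m. c l * Y l x)) \<and>
     (\<forall>l \<in> {1..h_dim CARD('d) m}. \<forall>l' \<in> {1..h_dim CARD('d) m}.
        sphere_inner \<kappa> (Y l) (Y l') = (if l = l' then 1 else 0))"

section \<open>Laguerre and Jacobi polynomials\<close>

text \<open>
  Generating function \<open>(1 - r)\<^sup>-\<^sup>\<alpha>\<^sup>-\<^sup>1 exp (- t r / (1 - r))\<close>, read as a formal power series in \<open>r\<close>.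
\<close>

definition laguerre :: "nat \<Rightarrow> real \<Rightarrow> real \<Rightarrow> real" where
  "laguerre n \<alpha> t = fps_nth
     ((fps_binomial (- \<alpha> - 1) oo (- fps_X)) * (fps_exp (- t) oo (fps_X / (1 - fps_X)))) n"

text \<open>
  The usual normalization \<open>(\<alpha> + 1)\<^sub>n / n! \<cdot> \<^sub>2F\<^sub>1(-n, n + \<alpha> + \<beta> + 1; \<alpha> + 1; (1 - x) / 2)\<close>, for
  \<open>\<alpha> > -1\<close>.
\<close>

definition jacobi :: "nat \<Rightarrow> real \<Rightarrow> real \<Rightarrow> real \<Rightarrow> real" where
  "jacobi n \<alpha> \<beta> x = pochhammer (\<alpha> + 1) n / fact n *
     (\<Sum>k\<le>n. pochhammer (- real n) k * pochhammer (real n + \<alpha> + \<beta> + 1) k /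
        (pochhammer (\<alpha> + 1) k * fact k) * ((1 - x) / 2) ^ k)"

section \<open>Orthogonal polynomials on the conic surface\<close>

definition w_laguerre :: "real ^ 'd \<Rightarrow> (real ^ 'd) \<times> real \<Rightarrow> real" where
  "w_laguerre \<kappa> = (\<lambda>(x, t). (h_weight \<kappa> x)\<^sup>2 * inverse t * exp (- t))"

definition w_jacobi :: "real ^ 'd \<Rightarrow> real \<Rightarrow> (real ^ 'd) \<times> real \<Rightarrow> real" where
  "w_jacobi \<kappa> \<gamma> = (\<lambda>(x, t). (h_weight \<kappa> x)\<^sup>2 * inverse t *
     (if t < 1 then (1 - t) powr \<gamma> else 0))"

definition cone_inner ::
  "((real ^ 'd) \<times> real \<Rightarrow> real) \<Rightarrow> ((real ^ 'd) \<times> real \<Rightarrow> real) \<Rightarrow>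
   ((real ^ 'd) \<times> real \<Rightarrow> real) \<Rightarrow> real" where
  "cone_inner w f g =
     (LINT z|cone_measure. f z * g z * w z) / (LINT z|cone_measure. w z)"

definition cone_laguerre ::
  "real ^ 'd \<Rightarrow> (nat \<Rightarrow> nat \<Rightarrow> real ^ 'd \<Rightarrow> real) \<Rightarrow> nat \<Rightarrow> nat \<Rightarrow> nat \<Rightarrow>
   (real ^ 'd) \<times> real \<Rightarrow> real" where
  "cone_laguerre \<kappa> Y n m l = (\<lambda>(x, t).
     laguerre (n - m) (2 * real m + 2 * abs_kappa \<kappa> + real CARD('d) - 2) t * Y m l x)"

definition cone_jacobi ::
  "real ^ 'd \<Rightarrow> real \<Rightarrow> (nat \<Rightarrow> nat \<Rightarrow> real ^ 'd \<Rightarrow> real) \<Rightarrow> nat \<Rightarrow> nat \<Rightarrow> nat \<Rightarrow>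
   (real ^ 'd) \<times> real \<Rightarrow> real" where
  "cone_jacobi \<kappa> \<gamma> Y n m l = (\<lambda>(x, t).
     jacobi (n - m) (2 * real m + 2 * abs_kappa \<kappa> + real CARD('d) - 2) \<gamma> (1 - 2 * t) * Y m l x)"

text \<open>The squared norms do not depend on \<open>l\<close>, but it is kept as a parameter.\<close>

definition sqnorm_laguerre ::
  "real ^ 'd \<Rightarrow> (nat \<Rightarrow> nat \<Rightarrow> real ^ 'd \<Rightarrow> real) \<Rightarrow> nat \<Rightarrow> nat \<Rightarrow> nat \<Rightarrow> real" where
  "sqnorm_laguerre \<kappa> Y n m l =
     cone_inner (w_laguerre \<kappa>) (cone_laguerre \<kappa> Y n m l) (cone_laguerre \<kappa> Y n m l)"

definition sqnorm_jacobi ::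
  "real ^ 'd \<Rightarrow> real \<Rightarrow> (nat \<Rightarrow> nat \<Rightarrow> real ^ 'd \<Rightarrow> real) \<Rightarrow> nat \<Rightarrow> nat \<Rightarrow> nat \<Rightarrow> real" where
  "sqnorm_jacobi \<kappa> \<gamma> Y n m l =
     cone_inner (w_jacobi \<kappa> \<gamma>) (cone_jacobi \<kappa> \<gamma> Y n m l) (cone_jacobi \<kappa> \<gamma> Y n m l)"

definition kernel_laguerre ::
  "real ^ 'd \<Rightarrow> (nat \<Rightarrow> nat \<Rightarrow> real ^ 'd \<Rightarrow> real) \<Rightarrow> nat \<Rightarrow>
   (real ^ 'd) \<times> real \<Rightarrow> (real ^ 'd) \<times> real \<Rightarrow> real" where
  "kernel_laguerre \<kappa> Y n z z' = (\<Sum>m = 0..n. \<Sum>l = 1..h_dim CARD('d) m.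
     cone_laguerre \<kappa> Y n m l z * cone_laguerre \<kappa> Y n m l z' / sqnorm_laguerre \<kappa> Y n m l)"

definition kernel_jacobi ::
  "real ^ 'd \<Rightarrow> real \<Rightarrow> (nat \<Rightarrow> nat \<Rightarrow> real ^ 'd \<Rightarrow> real) \<Rightarrow> nat \<Rightarrow>
   (real ^ 'd) \<times> real \<Rightarrow> (real ^ 'd) \<times> real \<Rightarrow> real" where
  "kernel_jacobi \<kappa> \<gamma> Y n z z' = (\<Sum>m = 0..n. \<Sum>l = 1..h_dim CARD('d) m.
     cone_jacobi \<kappa> \<gamma> Y n m l z * cone_jacobi \<kappa> \<gamma> Y n m l z' / sqnorm_jacobi \<kappa> \<gamma> Y n m l)"

end

theory Submission
  imports Defs
begin

text \<open>
  In polar coordinates on the cone the \<open>h\<close>-harmonic factor integrates to the same constant in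
  numerator and denominator of the inner products, so both squared norms are ratios of
  one-dimensional integrals against \<open>t\<^sup>2\<^sup>|\<^sup>\<kappa>\<^sup>|\<^sup>+\<^sup>d\<^sup>-\<^sup>2 v(t) dt\<close>, with \<open>v(t) = e\<^sup>-\<^sup>t\<close> or
  \<open>v(t) = (1 - t)\<^sup>\<gamma>\<close>. Substituting \<open>t / \<gamma>\<close> for \<open>t\<close>, the Jacobi weight tends to \<open>e\<^sup>-\<^sup>t\<close> and is
  dominated by it, so the rescaled moments converge; the coefficients of the rescaled Jacobi
  polynomial converge to those of the Laguerre polynomial. The limit of the norms follows by
  expanding the square, and that of the kernels termwise, since the limiting norms do not vanish.
\<close>

section \<open>Power expansions of the Laguerre and Jacobi polynomials\<close>

text \<open>Equals (\<alpha>+1)_n / n! times (-n)_k / ((\<alpha>+1)_k k!) with the quotient of the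
  two Pochhammer symbols of \<alpha>+1 already cancelled. The same number is the factor of the
  Jacobi coefficient that is free of \<beta>.\<close>

definition laguerre_coeff :: "nat \<Rightarrow> real \<Rightarrow> nat \<Rightarrow> real" where
  "laguerre_coeff n \<alpha> k =
     (- 1) ^ k * pochhammer (\<alpha> + 1 + real k) (n - k) / (fact (n - k) * fact k)"

text \<open>Coefficients of (1 - X)^(-a): composing with -X multiplies the n-th coefficient by
  (-1)^n, which cancels the sign of \<open>- a gchoose n\<close>.\<close>

lemma fps_nth_binomial_compose_minus_X:
  fixes a :: real
  shows "fps_nth (fps_binomial (- a) oo (- fps_X)) n = pochhammer a n / fact n"
proof -
  have "fps_nth (fps_binomial (- a) oo (- fps_X)) n = (- 1) ^ n * (- a gchoose n)"
    using fps_nth_compose_linear[of "fps_binomial (- a)" "- 1" n] by (simp flip: fps_const_neg)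
  also have "\<dots> = pochhammer a n / fact n"
    by (simp add: gbinomial_pochhammer power_mult_distrib[symmetric] flip: mult.assoc)
  finally show ?thesis .
qed

text \<open>Expand the exponential in powers of u = X / (1 - X). Multiplied by (1 -
  X)^(-\<alpha>-1), the k-th power becomes X^k (1 - X)^(-(\<alpha>+1+k)), whose n-th coefficient is
  known.\<close>

lemma laguerre_eq_sum: "laguerre n \<alpha> t = (\<Sum>k\<le>n. laguerre_coeff n \<alpha> k * t ^ k)"
proof -
  let ?c = "\<lambda>f :: real fps. f oo (- fps_X)"
  \<comment> \<open>\<open>?B b\<close> stands for (1 - X)^b.\<close>
  let ?B = "\<lambda>b. ?c (fps_binomial b)" and ?u = "fps_X / (1 - fps_X) :: real fps"
  have B1: "?B (- 1) = inverse (1 - fps_X)"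
    by (simp add: fps_binomial_minus_one fps_inverse_compose fps_compose_add_distrib)
  have u: "?u = fps_X * ?B (- 1)"
    unfolding B1 by (rule fps_divide_unit) simp
  have Bpow: "?B (- 1) ^ k = ?B (- real k)" for k
    by (subst fps_compose_power) (simp_all add: fps_binomial_power)
  have Bmult: "?B a * ?B b = ?B (a + b)" for a b
    by (simp add: fps_compose_mult_distrib[symmetric] fps_binomial_add_mult)
  have u_pow: "?B (- \<alpha> - 1) * ?u ^ k = fps_X ^ k * ?B (- (\<alpha> + 1 + real k))" for k
  proof -
    have "?B (- \<alpha> - 1) * ?u ^ k = fps_X ^ k * ?B (- \<alpha> - 1 + - real k)"
      unfolding u power_mult_distrib Bpow by (simp only: mult.left_commute Bmult)
    also have "- \<alpha> - 1 + - real k = - (\<alpha> + 1 + real k)" by simp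
    finally show ?thesis .
  qed
  have coeff: "fps_nth (?B (- \<alpha> - 1) * ?u ^ k) n =
      (if n < k then 0 else pochhammer (\<alpha> + 1 + real k) (n - k) / fact (n - k))" for k
    unfolding u_pow fps_X_power_mult_nth fps_nth_binomial_compose_minus_X by simp
  have u0: "fps_nth (?u ^ k) i = 0" if "i < k" for i k
    unfolding u power_mult_distrib using that by (simp add: fps_X_power_mult_nth)
  have "laguerre n \<alpha> t =
      (\<Sum>i=0..n. fps_nth (?B (- \<alpha> - 1)) i *
         (\<Sum>k=0..n-i. (- t) ^ k / fact k * fps_nth (?u ^ k) (n - i)))"
    by (simp add: laguerre_def fps_mult_nth fps_compose_nth)
  \<comment> \<open>Since u^k has no terms below degree k, the inner sum may run up to n; its range
    is then independent of i and the sums can be swapped.\<close>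
  also have "\<dots> = (\<Sum>i=0..n. fps_nth (?B (- \<alpha> - 1)) i *
         (\<Sum>k=0..n. (- t) ^ k / fact k * fps_nth (?u ^ k) (n - i)))"
    using u0 by (intro sum.cong refl arg_cong2[where f="(*)"] sum.mono_neutral_left) auto
  also have "\<dots> = (\<Sum>k=0..n. (- t) ^ k / fact k *
        (\<Sum>i=0..n. fps_nth (?B (- \<alpha> - 1)) i * fps_nth (?u ^ k) (n - i)))"
    unfolding sum_distrib_left by (subst sum.swap) (simp add: mult_ac)
  also have "\<dots> = (\<Sum>k=0..n. (- t) ^ k / fact k * fps_nth (?B (- \<alpha> - 1) * ?u ^ k) n)"
    by (simp only: fps_mult_nth)
  also have "\<dots> = (\<Sum>k\<le>n. laguerre_coeff n \<alpha> k * t ^ k)"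
    unfolding coeff atMost_atLeast0
    by (intro sum.cong) (auto simp: laguerre_coeff_def power_minus[of t] mult_ac)
  finally show ?thesis .
qed

text \<open>At 1 - 2t the hypergeometric variable is t, and \<beta> occurs only in
  (n+\<alpha>+\<beta>+1)_k. For \<alpha> > -1 the denominators (\<alpha>+1)_k are nonzero, so they
  cancel and leave the Laguerre coefficient.\<close>

lemma jacobi_eq_sum:
  assumes "\<alpha> > -1"
  shows "jacobi n \<alpha> \<beta> (1 - 2 * t) =
    (\<Sum>k\<le>n. laguerre_coeff n \<alpha> k * pochhammer (real n + \<alpha> + \<beta> + 1) k * t ^ k)"
proof -
  have "pochhammer (\<alpha> + 1) n / fact n * (pochhammer (- real n) k /
      (pochhammer (\<alpha> + 1) k * fact k)) = laguerre_coeff n \<alpha> k" if "k \<le> n" for k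
  proof -
    have "pochhammer (\<alpha> + 1) k \<noteq> 0"
      using assms pochhammer_pos[of "\<alpha> + 1" k] by simp
    moreover have "pochhammer (\<alpha> + 1) n =
        pochhammer (\<alpha> + 1) k * pochhammer (\<alpha> + 1 + real k) (n - k)"
      by (rule pochhammer_product[OF that])
    moreover have "pochhammer (- real n) k = (- 1) ^ k * fact n / fact (n - k)"
    proof -
      have "pochhammer (- real n) k = (- 1) ^ k * (fact k * (real n gchoose k))"
        by (simp add: gbinomial_pochhammer flip: mult.assoc power_mult_distrib)
      also have "fact k * (real n gchoose k) = fact n / fact (n - k)"
        using that by (simp add: binomial_gbinomial[symmetric] binomial_fact)
      finally show ?thesis by simp
    qed
    ultimately show ?thesis
      by (simp add: laguerre_coeff_def field_simps)
  qed
  then have "pochhammer (\<alpha> + 1) n / fact n * (pochhammer (- real n) k /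
      (pochhammer (\<alpha> + 1) k * fact k)) * (p * t ^ k) = laguerre_coeff n \<alpha> k * (p * t ^ k)"
    if "k \<le> n" for k p
    using that by simp
  then show ?thesis
    unfolding jacobi_def sum_distrib_left by (intro sum.cong refl) (simp add: mult.assoc)
qed

section \<open>Limit of the rescaled Jacobi polynomials\<close>

lemma tendsto_pochhammer_over_power:
  "((\<lambda>\<gamma>. pochhammer (b + \<gamma>) k / \<gamma> ^ k) \<longlongrightarrow> (1::real)) at_top"
proof (induction k)
  case (Suc k)
  have "((\<lambda>\<gamma>. (b + real k) / \<gamma> + 1) \<longlongrightarrow> 0 + 1) at_top"
    by (intro tendsto_add tendsto_const tendsto_divide_0[OF tendsto_const]
        filterlim_at_top_imp_at_infinity filterlim_ident)
  moreover have "\<forall>\<^sub>F \<gamma> in at_top. (b + real k) / \<gamma> + 1 = (b + \<gamma> + real k) / \<gamma>"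
    using eventually_gt_at_top[of 0] by eventually_elim (simp add: field_simps)
  ultimately have "((\<lambda>\<gamma>. (b + \<gamma> + real k) / \<gamma>) \<longlongrightarrow> 1) at_top"
    using Lim_transform_eventually by fastforce
  from tendsto_mult[OF Suc this] show ?case
    by (simp add: pochhammer_Suc mult_ac)
qed simp

lemma tendsto_jacobi_coeff:
  "((\<lambda>\<gamma>. laguerre_coeff n \<alpha> k * pochhammer (real n + \<alpha> + \<gamma> + 1) k / \<gamma> ^ k)
     \<longlongrightarrow> laguerre_coeff n \<alpha> k) at_top"
  using tendsto_mult[OF tendsto_const tendsto_pochhammer_over_power[of "real n + \<alpha> + 1" k],
      of "laguerre_coeff n \<alpha> k"]
  by (simp add: add_ac)

text \<open>Replacing t by t/\<gamma> puts \<gamma>^(-k) on the k-th term, which is exactly the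
  growth of its Pochhammer factor; the sum is finite, so the limit is termwise.\<close>

lemma tendsto_jacobi_laguerre:
  assumes "\<alpha> > -1"
  shows "((\<lambda>\<gamma>. jacobi n \<alpha> \<gamma> (1 - 2 * (t / \<gamma>))) \<longlongrightarrow> laguerre n \<alpha> t) at_top"
proof -
  have "((\<lambda>\<gamma>. \<Sum>k\<le>n. laguerre_coeff n \<alpha> k * pochhammer (real n + \<alpha> + \<gamma> + 1) k / \<gamma> ^ k * t ^ k)
      \<longlongrightarrow> (\<Sum>k\<le>n. laguerre_coeff n \<alpha> k * t ^ k)) at_top"
    by (intro tendsto_sum tendsto_mult tendsto_jacobi_coeff tendsto_const)
  then show ?thesis
    unfolding jacobi_eq_sum[OF assms] laguerre_eq_sum by (simp add: power_divide)
qed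

section \<open>One-dimensional weights and their moments\<close>

definition exp_weight :: "real \<Rightarrow> real" where
  "exp_weight t = exp (- t)"

definition jacobi_weight :: "real \<Rightarrow> real \<Rightarrow> real" where
  "jacobi_weight \<gamma> t = (if t < 1 then (1 - t) powr \<gamma> else 0)"

text \<open>For a > -1 this is Gamma(a+1) with \<open>exp_weight\<close> and the Beta value B(a+1,
  \<gamma>+1) with \<open>jacobi_weight \<gamma>\<close>, \<gamma> > -1. The limit below comes from
  dominated convergence rather than from these closed forms.\<close>

definition ray_moment :: "(real \<Rightarrow> real) \<Rightarrow> real \<Rightarrow> real" where
  "ray_moment v a = (LINT t|lborel. indicator {0..} t * t powr a * v t)"

lemma measurable_exp_weight [measurable]: "exp_weight \<in> borel_measurable borel"
  unfolding exp_weight_def[abs_def] by measurable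

lemma measurable_jacobi_weight [measurable]: "jacobi_weight \<gamma> \<in> borel_measurable borel"
  unfolding jacobi_weight_def[abs_def] by measurable

lemma jacobi_weight_nonneg: "jacobi_weight \<gamma> t \<ge> 0"
  by (simp add: jacobi_weight_def)

text \<open>Raise 1 - t \<le> e^(-t) to the power \<gamma>; from t = 1 on the weight is
  zero.\<close>

lemma jacobi_weight_le_exp:
  assumes "\<gamma> > 0"
  shows "jacobi_weight \<gamma> t \<le> exp (- (\<gamma> * t))"
proof (cases "t < 1")
  case True
  have "(1 - t) powr \<gamma> \<le> exp (- t) powr \<gamma>"
    using assms True exp_ge_add_one_self[of "- t"] by (intro powr_mono2) auto
  then show ?thesis using True by (simp add: jacobi_weight_def powr_def mult_ac)
qed (simp add: jacobi_weight_def)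

lemma integrable_ray_exp_weight:
  assumes "a > -1"
  shows "integrable lborel (\<lambda>t. indicator {0..} t * t powr a * exp_weight t)"
proof (rule integrableI_nonneg)
  have "(\<integral>\<^sup>+ t. ennreal (indicator {0..} t * t powr a * exp_weight t) \<partial>lborel) = Gamma (a + 1)"
    using Gamma_conv_nn_integral_real[of "a + 1"] assms
    by (simp add: exp_weight_def exp_minus field_simps)
  then show "(\<integral>\<^sup>+ t. ennreal (indicator {0..} t * t powr a * exp_weight t) \<partial>lborel) < \<infinity>"
    by simp
qed (auto simp: exp_weight_def)

text \<open>With \<gamma> \<ge> 1 the bound e^(-\<gamma> t) is at most e^(-t) on the half-line, so
  the Gamma integrand is a majorant.\<close>

lemma integrable_ray_jacobi_weight:
  assumes "a > -1" "\<gamma> \<ge> 1"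
  shows "integrable lborel (\<lambda>t. indicator {0..} t * t powr a * jacobi_weight \<gamma> t)"
proof (rule Bochner_Integration.integrable_bound[OF integrable_ray_exp_weight[OF assms(1)]])
  have "jacobi_weight \<gamma> t \<le> exp_weight t" if "t \<ge> 0" for t
  proof -
    have "jacobi_weight \<gamma> t \<le> exp (- (\<gamma> * t))"
      using assms by (intro jacobi_weight_le_exp) simp
    also have "\<dots> \<le> exp_weight t"
      using mult_right_mono[OF assms(2) that] by (simp add: exp_weight_def)
    finally show ?thesis .
  qed
  then show "AE t in lborel. norm (indicator {0..} t * t powr a * jacobi_weight \<gamma> t)
      \<le> norm (indicator {0..} t * t powr a * exp_weight t)"
    by (intro AE_I2)
      (auto simp: abs_mult jacobi_weight_nonneg exp_weight_def indicator_def intro!: mult_left_mono)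
qed measurable

lemma tendsto_jacobi_weight:
  "((\<lambda>\<gamma>. jacobi_weight \<gamma> (t / \<gamma>)) \<longlongrightarrow> exp_weight t) at_top"
proof (rule Lim_transform_eventually)
  show "((\<lambda>\<gamma>. (1 + - t / \<gamma>) powr \<gamma>) \<longlongrightarrow> exp_weight t) at_top"
    unfolding exp_weight_def by (rule tendsto_exp_limit_at_top)
  show "\<forall>\<^sub>F \<gamma> in at_top. (1 + - t / \<gamma>) powr \<gamma> = jacobi_weight \<gamma> (t / \<gamma>)"
    \<comment> \<open>Once \<gamma> exceeds both 0 and t, t/\<gamma> < 1 and the nonzero branch of
      the weight applies.\<close>
    using eventually_gt_at_top[of "max 0 t"]
    by eventually_elim (simp add: jacobi_weight_def)
qed

text \<open>Substituting t/\<gamma> for t yields \<gamma>^(-a) from the power and 1/\<gamma> from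
  dt.\<close>

lemma ray_moment_jacobi_weight_scaled:
  assumes "\<gamma> > 0"
  shows "\<gamma> powr (a + 1) * ray_moment (jacobi_weight \<gamma>) a =
    (LINT t|lborel. indicator {0..} t * t powr a * jacobi_weight \<gamma> (t / \<gamma>))"
proof -
  have "ray_moment (jacobi_weight \<gamma>) a = \<bar>1 / \<gamma>\<bar> * (LINT t|lborel.
      indicator {0..} (t / \<gamma>) * (t / \<gamma>) powr a * jacobi_weight \<gamma> (t / \<gamma>))"
    unfolding ray_moment_def using assms
    by (subst lborel_integral_real_affine[where c = "1 / \<gamma>" and t = 0]) auto
  also have "(LINT t|lborel. indicator {0..} (t / \<gamma>) * (t / \<gamma>) powr a * jacobi_weight \<gamma> (t / \<gamma>)) =
      (LINT t|lborel. \<gamma> powr (- a) * (indicator {0..} t * t powr a * jacobi_weight \<gamma> (t / \<gamma>)))"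
    using assms
    by (intro Bochner_Integration.integral_cong refl)
      (auto simp: indicator_def powr_divide powr_minus field_simps)
  also have "\<dots> = \<gamma> powr (- a) * (LINT t|lborel. indicator {0..} t * t powr a * jacobi_weight \<gamma> (t / \<gamma>))"
    by simp
  finally show ?thesis
    using assms by (simp add: powr_add powr_minus field_simps)
qed

lemma tendsto_ray_moment:
  assumes "a > -1"
  shows "((\<lambda>\<gamma>. \<gamma> powr (a + 1) * ray_moment (jacobi_weight \<gamma>) a)
    \<longlongrightarrow> ray_moment exp_weight a) at_top"
proof (rule Lim_transform_eventually)
  show "((\<lambda>\<gamma>. LINT t|lborel. indicator {0..} t * t powr a * jacobi_weight \<gamma> (t / \<gamma>))
      \<longlongrightarrow> ray_moment exp_weight a) at_top"
    unfolding ray_moment_def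
  proof (rule integral_dominated_convergence_at_top[OF _ _ integrable_ray_exp_weight[OF assms]])
    show "\<forall>\<^sub>F \<gamma> in at_top. AE t in lborel.
        norm (indicator {0..} t * t powr a * jacobi_weight \<gamma> (t / \<gamma>))
        \<le> indicator {0..} t * t powr a * exp_weight t"
      using eventually_gt_at_top[of 0]
    proof eventually_elim
      case (elim \<gamma>)
      have "jacobi_weight \<gamma> (t / \<gamma>) \<le> exp_weight t" for t
        using jacobi_weight_le_exp[OF elim, of "t / \<gamma>"] elim by (simp add: exp_weight_def)
      then show ?case
        by (intro AE_I2)
          (auto simp: abs_mult jacobi_weight_nonneg indicator_def intro!: mult_left_mono)
    qed
    show "AE t in lborel. ((\<lambda>\<gamma>. indicator {0..} t * t powr a * jacobi_weight \<gamma> (t / \<gamma>))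
        \<longlongrightarrow> indicator {0..} t * t powr a * exp_weight t) at_top"
      by (intro AE_I2 tendsto_mult tendsto_const tendsto_jacobi_weight)
  qed measurable
  show "\<forall>\<^sub>F \<gamma> in at_top.
      (LINT t|lborel. indicator {0..} t * t powr a * jacobi_weight \<gamma> (t / \<gamma>)) =
      \<gamma> powr (a + 1) * ray_moment (jacobi_weight \<gamma>) a"
    using eventually_gt_at_top[of 0]
    by eventually_elim (rule ray_moment_jacobi_weight_scaled[symmetric])
qed

section \<open>Polar coordinates on the conic surface\<close>

text \<open>Fubini for signed integrands that separate into a radial and a spherical factor;
  integrability of the two factors gives that of the product.\<close>

lemma integral_cone_measure_product:
  fixes F :: "real ^ 'd \<Rightarrow> real"
  assumes \<phi> [measurable]: "\<phi> \<in> borel_measurable (borel :: ((real ^ 'd) \<times> real) measure)"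
    and G [measurable]: "G \<in> borel_measurable borel"
    and \<phi>_eq: "\<And>t \<xi>. \<phi> (t *\<^sub>R \<xi>, t) = G t * F \<xi>"
    and intG: "integrable lborel (\<lambda>t. indicator {0..} t * t ^ (CARD('d) - 1) * G t)"
    and intF: "integrable sphere_measure F"
  shows "(LINT z|cone_measure. \<phi> z) =
    (LINT t|lborel. indicator {0..} t * t ^ (CARD('d) - 1) * G t) * (LINT \<xi>|sphere_measure. F \<xi>)"
proof -
  let ?S = "sphere_measure :: (real ^ 'd) measure"
  let ?r = "\<lambda>t::real. indicator {0..} t * t ^ (CARD('d) - 1) :: real"
  let ?D = "density lborel (\<lambda>t. ennreal (?r t))"
  interpret S: finite_measure ?S by (rule finite_sphere_measure)
  \<comment> \<open>The radial density takes only finite values, so it preserves sigma-finiteness of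
    Lebesgue measure.\<close>
  interpret D: sigma_finite_measure ?D
    by (subst sigma_finite_measure.sigma_finite_iff_density_finite[OF sigma_finite_lborel]) auto
  interpret pair_sigma_finite ?D ?S ..
  have r: "?r t \<ge> 0" for t by (simp add: indicator_def)
  have m [measurable]: "(\<lambda>(t, \<xi>). (t *\<^sub>R \<xi>, t)) \<in> ?D \<Otimes>\<^sub>M ?S \<rightarrow>\<^sub>M borel"
    by (simp add: borel_prod [symmetric]) measurable
  have Fm: "F \<in> borel_measurable ?S" using intF by auto
  note Fm [measurable]
  have D: "integrable ?D G" "(LINT t|?D. G t) = (LINT t|lborel. ?r t * G t)"
    using intG r by (auto simp: integrable_real_density integral_density)
  have "integrable (?D \<Otimes>\<^sub>M ?S) (\<lambda>z. G (fst z) * F (snd z))"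
  proof (rule Fubini_integrable)
    show "(\<lambda>z. G (fst z) * F (snd z)) \<in> borel_measurable (?D \<Otimes>\<^sub>M ?S)" by measurable
    show "integrable ?D (\<lambda>t. \<integral> \<xi>. norm (G (fst (t, \<xi>)) * F (snd (t, \<xi>))) \<partial>?S)"
      using D by (simp add: abs_mult)
    show "AE t in ?D. integrable ?S (\<lambda>\<xi>. G (fst (t, \<xi>)) * F (snd (t, \<xi>)))"
      using intF by simp
  qed
  from integral_fst'[OF this]
  have "(LINT z|(?D \<Otimes>\<^sub>M ?S). G (fst z) * F (snd z)) = (LINT t|?D. G t) * (LINT \<xi>|?S. F \<xi>)"
    by simp
  moreover have "(LINT z|cone_measure. \<phi> z) = (LINT z|(?D \<Otimes>\<^sub>M ?S). G (fst z) * F (snd z))"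
    unfolding cone_measure_def by (subst integral_distr[OF m \<phi>]) (simp add: case_prod_beta \<phi>_eq)
  ultimately show ?thesis using D by simp
qed

lemma monomial_scaleR: "monomial a (t *\<^sub>R x) = t ^ (\<Sum>i\<in>UNIV. a i) * monomial a x"
  by (simp add: monomial_def power_mult_distrib prod.distrib power_sum)

lemma homogeneous_polys_scaleR:
  assumes "p \<in> homogeneous_polys m"
  shows "p (t *\<^sub>R x) = t ^ m * p x"
proof -
  from assms obtain c where p: "p = (\<lambda>x. \<Sum>a | (\<Sum>i\<in>UNIV. a i) = m. c a * monomial a x)"
    by (auto simp: homogeneous_polys_def)
  show ?thesis
    unfolding p sum_distrib_left by (intro sum.cong) (auto simp: monomial_scaleR mult_ac)
qed

lemma measurable_homogeneous_polys:
  assumes "p \<in> homogeneous_polys m"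
  shows "p \<in> borel_measurable borel"
  using assms unfolding homogeneous_polys_def monomial_def[abs_def] by auto

lemma measurable_h_weight [measurable]: "h_weight \<kappa> \<in> borel_measurable borel"
  unfolding h_weight_def[abs_def] by measurable

text \<open>Homogeneity of degree |\<kappa>|. It fails at t = 0 for \<kappa> = 0, where
  \<open>h_weight\<close> is 1 but \<open>0 powr 0 = 0\<close>.\<close>

lemma h_weight_scaleR:
  assumes "t \<noteq> 0"
  shows "h_weight \<kappa> (t *\<^sub>R x) = \<bar>t\<bar> powr abs_kappa \<kappa> * h_weight \<kappa> x"
proof -
  have "h_weight \<kappa> (t *\<^sub>R x) =
      (\<Prod>i\<in>UNIV. \<bar>t\<bar> powr (\<kappa> $ i) * (if \<kappa> $ i = 0 then 1 else \<bar>x $ i\<bar> powr (\<kappa> $ i)))"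
    unfolding h_weight_def using assms
    by (intro prod.cong refl) (auto simp: abs_mult powr_mult)
  then show ?thesis
    using assms by (simp add: prod.distrib h_weight_def abs_kappa_def powr_sum)
qed

text \<open>Common shape of the two cone weights, so that the norm integral is computed once for
  both.\<close>

definition radial_weight :: "real ^ 'd \<Rightarrow> (real \<Rightarrow> real) \<Rightarrow> (real ^ 'd) \<times> real \<Rightarrow> real" where
  "radial_weight \<kappa> v = (\<lambda>(x, t). (h_weight \<kappa> x)\<^sup>2 * inverse t * v t)"

lemma w_laguerre_eq: "w_laguerre \<kappa> = radial_weight \<kappa> exp_weight"
  by (simp add: w_laguerre_def radial_weight_def exp_weight_def)

lemma w_jacobi_eq: "w_jacobi \<kappa> \<gamma> = radial_weight \<kappa> (jacobi_weight \<gamma>)"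
  by (simp add: w_jacobi_def radial_weight_def jacobi_weight_def)

text \<open>The exponent of t collects d-1 from the measure, j from g, 2|\<kappa>| from the squared
  \<open>h_weight\<close> and -1 from the factor 1/t.\<close>

lemma integral_radial_weight:
  fixes \<kappa> :: "real ^ 'd" and g :: "real ^ 'd \<Rightarrow> real"
  assumes [measurable]: "v \<in> borel_measurable borel" "q \<in> borel_measurable borel"
      "g \<in> borel_measurable borel"
    and g: "\<And>t x. g (t *\<^sub>R x) = t ^ j * g x"
    and intg: "integrable sphere_measure (\<lambda>\<xi>. g \<xi> * (h_weight \<kappa> \<xi>)\<^sup>2)"
    and intq: "integrable lborel (\<lambda>t. indicator {0..} t *
      t powr (real j + (2 * abs_kappa \<kappa> + real CARD('d) - 2)) * (q t * v t))"
  shows "(LINT z|cone_measure. q (snd z) * g (fst z) * radial_weight \<kappa> v z) =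
    (LINT t|lborel. indicator {0..} t *
      t powr (real j + (2 * abs_kappa \<kappa> + real CARD('d) - 2)) * (q t * v t)) *
    (LINT \<xi>|sphere_measure. g \<xi> * (h_weight \<kappa> \<xi>)\<^sup>2)"
proof -
  \<comment> \<open>The absolute value makes the factorization valid for negative t too; at t = 0
    both sides vanish because \<open>inverse 0 = 0\<close>.\<close>
  let ?G = "\<lambda>t. q t * t ^ j * (\<bar>t\<bar> powr abs_kappa \<kappa>)\<^sup>2 * inverse t * v t"
  have G: "indicator {0..} t * t powr (real j + (2 * abs_kappa \<kappa> + real CARD('d) - 2)) * (q t * v t) =
      indicator {0..} t * t ^ (CARD('d) - 1) * ?G t" for t :: real
  proof (cases "t > 0")
    case True
    have "t powr (real j + (2 * abs_kappa \<kappa> + real CARD('d) - 2)) =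
        t powr (real (CARD('d) - 1) + real j + (abs_kappa \<kappa> + abs_kappa \<kappa>) + (- 1))"
      by (rule arg_cong[where f = "(powr) t"]) simp
    also have "\<dots> = t ^ (CARD('d) - 1) * t ^ j * (\<bar>t\<bar> powr abs_kappa \<kappa>)\<^sup>2 * inverse t"
      unfolding powr_add using True
      by (simp add: powr_realpow powr_minus power2_eq_square del: of_nat_diff)
    finally show ?thesis by simp
  next
    case False
    then show ?thesis by (cases "t = 0") (auto simp: indicator_def)
  qed
  show ?thesis unfolding G
  proof (rule integral_cone_measure_product)
    show "(\<lambda>z. q (snd z) * g (fst z) * radial_weight \<kappa> v z) \<in>
        borel_measurable (borel :: ((real ^ 'd) \<times> real) measure)"
      unfolding radial_weight_def case_prod_beta borel_prod[symmetric] by measurable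
    show "?G \<in> borel_measurable borel" by measurable
    show "integrable lborel (\<lambda>t. indicator {0..} t * t ^ (CARD('d) - 1) * ?G t)"
      using intq unfolding G .
    show "q (snd (t *\<^sub>R \<xi>, t)) * g (fst (t *\<^sub>R \<xi>, t)) * radial_weight \<kappa> v (t *\<^sub>R \<xi>, t) =
        ?G t * (g \<xi> * (h_weight \<kappa> \<xi>)\<^sup>2)" for t and \<xi> :: "real ^ 'd"
      by (cases "t = 0") (auto simp: radial_weight_def g h_weight_scaleR power_mult_distrib)
  qed (rule intg)
qed

section \<open>Squares of polynomials on the half-line\<close>

lemma ray_integrand_poly_square:
  fixes c :: "nat \<Rightarrow> real"
  shows "indicator {0..} t * t powr a * ((\<Sum>k\<le>N. c k * t ^ k)\<^sup>2 * v t) =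
    (\<Sum>i\<le>N. \<Sum>k\<le>N. c i * c k * (indicator {0..} t * t powr (a + real (i + k)) * v t))"
proof -
  have *: "indicator {0..} t * t powr a * (t ^ i * t ^ k) =
      (indicator {0..} t * t powr (a + real (i + k)) :: real)" for i k
    by (cases "t > 0") (auto simp: powr_add powr_realpow power_add indicator_def)
  have "indicator {0..} t * t powr a * ((\<Sum>k\<le>N. c k * t ^ k)\<^sup>2 * v t) =
      (\<Sum>i\<le>N. \<Sum>k\<le>N. c i * c k * (indicator {0..} t * t powr a * (t ^ i * t ^ k) * v t))"
    by (simp add: power2_eq_square sum_product sum_distrib_left sum_distrib_right mult_ac)
  then show ?thesis unfolding * .
qed

text \<open>Every exponent arising from the square is at least a, hence the integrability assumption
  for all b \<ge> a.\<close>

lemma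
  fixes c :: "nat \<Rightarrow> real"
  assumes int: "\<And>b. b \<ge> a \<Longrightarrow> integrable lborel (\<lambda>t. indicator {0..} t * t powr b * v t)"
  shows integrable_ray_poly_square: "integrable lborel
      (\<lambda>t. indicator {0..} t * t powr a * ((\<Sum>k\<le>N. c k * t ^ k)\<^sup>2 * v t))"
    and integral_ray_poly_square:
      "(LINT t|lborel. indicator {0..} t * t powr a * ((\<Sum>k\<le>N. c k * t ^ k)\<^sup>2 * v t)) =
       (\<Sum>i\<le>N. \<Sum>k\<le>N. c i * c k * ray_moment v (a + real (i + k)))"
  unfolding ray_integrand_poly_square ray_moment_def using int by auto

text \<open>A nonnegative integrand with integral 0 vanishes almost everywhere. Since c 0 \<noteq>
  0, the polynomial has finitely many roots, and off them the integrand is positive on (0,1), which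
  would then be a null set.\<close>

lemma integral_ray_poly_square_pos:
  fixes c :: "nat \<Rightarrow> real"
  assumes "a > -1" and "c 0 \<noteq> 0"
  shows "(LINT t|lborel. indicator {0..} t * t powr a * ((\<Sum>k\<le>N. c k * t ^ k)\<^sup>2 * exp_weight t)) > 0"
    (is "integral\<^sup>L lborel ?f > 0")
proof (rule ccontr)
  assume "\<not> integral\<^sup>L lborel ?f > 0"
  moreover have nonneg: "?f t \<ge> 0" for t
    by (simp add: exp_weight_def)
  moreover have "integral\<^sup>L lborel ?f \<ge> 0"
    using nonneg by (rule Bochner_Integration.integral_nonneg)
  moreover have "integrable lborel ?f"
    using assms(1) by (intro integrable_ray_poly_square integrable_ray_exp_weight) auto
  ultimately have "AE t in lborel. ?f t = 0"
    using integral_nonneg_eq_0_iff_AE[of lborel ?f] by force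
  moreover have "AE t in lborel. t \<notin> {t. (\<Sum>k\<le>N. c k * t ^ k) = 0}"
    using polyfun_rootbound_finite[of N c] assms(2)
    by (intro AE_not_in finite_imp_null_set_lborel) auto
  ultimately have "AE t in lborel. t \<notin> {0<..<1::real}"
    by eventually_elim (auto simp: exp_weight_def)
  then have "{0<..<1::real} \<in> null_sets lborel"
    by (subst AE_iff_null_sets) auto
  then show False by (simp add: null_sets_def)
qed

lemma ray_moment_exp_weight_pos: "a > -1 \<Longrightarrow> ray_moment exp_weight a > 0"
  using integral_ray_poly_square_pos[of a "\<lambda>_. 1" 0] by (simp add: ray_moment_def)

section \<open>Squared norms as one-dimensional integrals\<close>

text \<open>Normalization of y makes the spherical factors of numerator and denominator equal. The
  quotient left over depends on y only through its degree m, so the norms do not depend on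
  l.\<close>

lemma cone_inner_radial_weight:
  fixes \<kappa> :: "real ^ 'd" and y :: "real ^ 'd \<Rightarrow> real" and c :: "nat \<Rightarrow> real" and N :: nat
  defines "\<alpha> \<equiv> 2 * abs_kappa \<kappa> + real CARD('d) - 2"
  defines "p \<equiv> \<lambda>t. \<Sum>k\<le>N. c k * t ^ k"
  assumes [measurable]: "v \<in> borel_measurable borel"
    and int: "\<And>b. b \<ge> \<alpha> \<Longrightarrow> integrable lborel (\<lambda>t. indicator {0..} t * t powr b * v t)"
    and y: "y \<in> homogeneous_polys m" "sphere_inner \<kappa> y y = 1"
  shows "cone_inner (radial_weight \<kappa> v) (\<lambda>(x, t). p t * y x) (\<lambda>(x, t). p t * y x) =
    (LINT t|lborel. indicator {0..} t * t powr (2 * real m + \<alpha>) * ((p t)\<^sup>2 * v t)) / ray_moment v \<alpha>"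
proof -
  let ?H = "LINT \<xi>|sphere_measure. (h_weight \<kappa> \<xi>)\<^sup>2"
  let ?S = "LINT \<xi>|sphere_measure. (y \<xi>)\<^sup>2 * (h_weight \<kappa> \<xi>)\<^sup>2"
  note [measurable] = measurable_homogeneous_polys[OF y(1)]
  \<comment> \<open>If \<open>?H\<close> were 0, the quotient in \<open>sphere_inner\<close> would
    be 0 by convention, not 1.\<close>
  have S: "?S = ?H" "?H \<noteq> 0"
    using y(2) by (auto simp: sphere_inner_def power2_eq_square)
  \<comment> \<open>A function that is not integrable has integral \<open>0\<close>, so the normalization of \<open>y\<close> forces
    integrability.\<close>
  have intS: "integrable sphere_measure (\<lambda>\<xi>. (y \<xi>)\<^sup>2 * (h_weight \<kappa> \<xi>)\<^sup>2)"
      "integrable sphere_measure (\<lambda>\<xi>. (h_weight \<kappa> \<xi>)\<^sup>2)"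
    by (rule ccontr, use S in \<open>simp add: not_integrable_integral_eq\<close>)+
  have "(LINT z|cone_measure. (p (snd z))\<^sup>2 * (y (fst z))\<^sup>2 * radial_weight \<kappa> v z) =
      (LINT t|lborel. indicator {0..} t * t powr (real (2 * m) + \<alpha>) * ((p t)\<^sup>2 * v t)) * ?S"
    unfolding \<alpha>_def
  proof (rule integral_radial_weight)
    show "(y (t *\<^sub>R x))\<^sup>2 = t ^ (2 * m) * (y x)\<^sup>2" for t x
      by (simp add: homogeneous_polys_scaleR[OF y(1)] power_mult_distrib power_mult[symmetric] mult.commute)
    show "integrable lborel (\<lambda>t. indicator {0..} t *
        t powr (real (2 * m) + (2 * abs_kappa \<kappa> + real CARD('d) - 2)) * ((p t)\<^sup>2 * v t))"
      unfolding p_def using int by (intro integrable_ray_poly_square) (simp add: \<alpha>_def)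
  qed (use intS in \<open>simp_all add: p_def\<close>)
  moreover have "(LINT z|cone_measure. 1 * 1 * radial_weight \<kappa> v z) =
      (LINT t|lborel. indicator {0..} t * t powr (real 0 + \<alpha>) * (1 * v t)) * (LINT \<xi>|sphere_measure. 1 * (h_weight \<kappa> \<xi>)\<^sup>2)"
    unfolding \<alpha>_def
    by (rule integral_radial_weight) (use intS int[of \<alpha>] in \<open>simp_all add: \<alpha>_def\<close>)
  ultimately show ?thesis
    using S by (simp add: cone_inner_def case_prod_beta power2_eq_square ray_moment_def mult_ac)
qed

lemma laguerre_coeff_0: "\<alpha> > -1 \<Longrightarrow> laguerre_coeff n \<alpha> 0 \<noteq> 0"
  using pochhammer_pos[of "\<alpha> + 1" n] by (simp add: laguerre_coeff_def)

section \<open>Limits of the norms, the basis functions and the kernels\<close>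

context
  fixes \<kappa> :: "real ^ 'd" and Y :: "nat \<Rightarrow> nat \<Rightarrow> real ^ 'd \<Rightarrow> real"
  assumes dim: "CARD('d) \<ge> 2"
    and \<kappa>_nonneg: "\<And>i. \<kappa> $ i \<ge> 0"
    and Y: "\<And>k. orthonormal_h_basis \<kappa> k (Y k)"
begin

abbreviation cone_exponent :: real where
  "cone_exponent \<equiv> 2 * abs_kappa \<kappa> + real CARD('d) - 2"

text \<open>Here d \<ge> 2 and \<kappa> \<ge> 0 enter: they keep all exponents above -1, so that the
  moments exist and the Jacobi expansion applies.\<close>

lemma cone_exponent_nonneg: "cone_exponent \<ge> 0"
proof -
  have "abs_kappa \<kappa> \<ge> 0"
    unfolding abs_kappa_def using \<kappa>_nonneg by (intro sum_nonneg) auto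
  then show ?thesis using dim by linarith
qed

lemma orthonormal_h_basisD:
  assumes "1 \<le> l" "l \<le> h_dim CARD('d) m"
  shows "Y m l \<in> homogeneous_polys m" "sphere_inner \<kappa> (Y m l) (Y m l) = 1"
  using Y[of m] assms by (auto simp: orthonormal_h_basis_def h_harmonics_def)

text \<open>The integral of a square serves to show that the norm is nonzero; the double sum of
  moments derived from it in \<open>sqnorm_laguerre_eq_sum\<close> serves for the limit.\<close>

lemma sqnorm_laguerre_eq:
  fixes n m l :: nat
  assumes "1 \<le> l" "l \<le> h_dim CARD('d) m"
  defines "c \<equiv> laguerre_coeff (n - m) (2 * real m + cone_exponent)"
  shows "sqnorm_laguerre \<kappa> Y n m l =
      (LINT t|lborel. indicator {0..} t * t powr (2 * real m + cone_exponent) *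
        ((\<Sum>k\<le>n - m. c k * t ^ k)\<^sup>2 * exp_weight t)) / ray_moment exp_weight cone_exponent"
proof -
  have "cone_laguerre \<kappa> Y n m l = (\<lambda>(x, t). (\<Sum>k\<le>n - m. c k * t ^ k) * Y m l x)"
    unfolding cone_laguerre_def laguerre_eq_sum c_def by (simp add: add_diff_eq add.assoc)
  then show ?thesis
    unfolding sqnorm_laguerre_def w_laguerre_eq using cone_exponent_nonneg
    by (simp only:, intro cone_inner_radial_weight integrable_ray_exp_weight orthonormal_h_basisD assms)
      auto
qed

lemma sqnorm_laguerre_nonzero:
  assumes "1 \<le> l" "l \<le> h_dim CARD('d) m"
  shows "sqnorm_laguerre \<kappa> Y n m l \<noteq> 0"
proof -
  let ?c = "laguerre_coeff (n - m) (2 * real m + cone_exponent)"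
  have "(LINT t|lborel. indicator {0..} t * t powr (2 * real m + cone_exponent) *
      ((\<Sum>k\<le>n - m. ?c k * t ^ k)\<^sup>2 * exp_weight t)) > 0"
    using cone_exponent_nonneg by (intro integral_ray_poly_square_pos laguerre_coeff_0) auto
  moreover have "ray_moment exp_weight cone_exponent > 0"
    using cone_exponent_nonneg by (intro ray_moment_exp_weight_pos) auto
  ultimately show ?thesis
    unfolding sqnorm_laguerre_eq[OF assms] by simp
qed

lemma sqnorm_laguerre_eq_sum:
  fixes n m l :: nat
  assumes "1 \<le> l" "l \<le> h_dim CARD('d) m"
  defines "c \<equiv> laguerre_coeff (n - m) (2 * real m + cone_exponent)"
  shows "sqnorm_laguerre \<kappa> Y n m l =
      (\<Sum>i\<le>n - m. \<Sum>k\<le>n - m. c i * c k *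
        ray_moment exp_weight (2 * real m + cone_exponent + real (i + k))) /
      ray_moment exp_weight cone_exponent"
  unfolding sqnorm_laguerre_eq[OF assms(1,2)] c_def using cone_exponent_nonneg
  by (subst integral_ray_poly_square) (auto intro!: integrable_ray_exp_weight)

lemma sqnorm_jacobi_eq_sum:
  fixes n m l :: nat
  assumes "1 \<le> l" "l \<le> h_dim CARD('d) m" "\<gamma> \<ge> 1"
  defines "\<alpha> \<equiv> 2 * real m + cone_exponent"
  defines "c \<equiv> \<lambda>k. laguerre_coeff (n - m) \<alpha> k * pochhammer (real (n - m) + \<alpha> + \<gamma> + 1) k"
  shows "sqnorm_jacobi \<kappa> \<gamma> Y n m l =
      (\<Sum>i\<le>n - m. \<Sum>k\<le>n - m. c i * c k * ray_moment (jacobi_weight \<gamma>) (\<alpha> + real (i + k))) /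
      ray_moment (jacobi_weight \<gamma>) cone_exponent"
proof -
  have \<alpha>: "\<alpha> \<ge> 0" using cone_exponent_nonneg by (simp add: \<alpha>_def)
  have "cone_jacobi \<kappa> \<gamma> Y n m l = (\<lambda>(x, t). (\<Sum>k\<le>n - m. c k * t ^ k) * Y m l x)"
    unfolding cone_jacobi_def c_def using \<alpha>
    by (subst jacobi_eq_sum[symmetric]) (auto simp: \<alpha>_def add_diff_eq add.assoc)
  then have "sqnorm_jacobi \<kappa> \<gamma> Y n m l =
      (LINT t|lborel. indicator {0..} t * t powr \<alpha> *
        ((\<Sum>k\<le>n - m. c k * t ^ k)\<^sup>2 * jacobi_weight \<gamma> t)) / ray_moment (jacobi_weight \<gamma>) cone_exponent"
    unfolding sqnorm_jacobi_def w_jacobi_eq \<alpha>_def using cone_exponent_nonneg assms(3)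
    by (simp only:, intro cone_inner_radial_weight integrable_ray_jacobi_weight
        orthonormal_h_basisD assms(1,2)) auto
  also have "(LINT t|lborel. indicator {0..} t * t powr \<alpha> *
        ((\<Sum>k\<le>n - m. c k * t ^ k)\<^sup>2 * jacobi_weight \<gamma> t)) =
      (\<Sum>i\<le>n - m. \<Sum>k\<le>n - m. c i * c k * ray_moment (jacobi_weight \<gamma>) (\<alpha> + real (i + k)))"
    using \<alpha> assms(3) by (intro integral_ray_poly_square integrable_ray_jacobi_weight) auto
  finally show ?thesis .
qed

text \<open>Coefficients are divided by \<gamma>^i and \<gamma>^k, moments multiplied by
  \<gamma>^(\<alpha>+i+k+1), and the normalizing moment by \<gamma>^(e+1) with e =
  \<open>cone_exponent\<close>. As \<alpha> - e = 2m, the net factor is \<gamma>^(2m) in every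
  term.\<close>

lemma tendsto_sqnorm_jacobi:
  assumes l: "1 \<le> l" "l \<le> h_dim CARD('d) m"
  shows "((\<lambda>\<gamma>. \<gamma> ^ (2 * m) * sqnorm_jacobi \<kappa> \<gamma> Y n m l)
    \<longlongrightarrow> sqnorm_laguerre \<kappa> Y n m l) at_top"
proof (rule Lim_transform_eventually)
  define \<alpha> where "\<alpha> = 2 * real m + cone_exponent"
  define N where "N = n - m"
  define c where "c \<gamma> k = laguerre_coeff N \<alpha> k * pochhammer (real N + \<alpha> + \<gamma> + 1) k" for \<gamma> k
  define M where "M \<gamma> a = ray_moment (jacobi_weight \<gamma>) a" for \<gamma> a
  have \<alpha>: "\<alpha> \<ge> 0" using cone_exponent_nonneg by (simp add: \<alpha>_def)
  show "((\<lambda>\<gamma>. (\<Sum>i\<le>N. \<Sum>k\<le>N. c \<gamma> i / \<gamma> ^ i * (c \<gamma> k / \<gamma> ^ k) *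
        (\<gamma> powr (\<alpha> + real (i + k) + 1) * M \<gamma> (\<alpha> + real (i + k)))) /
      (\<gamma> powr (cone_exponent + 1) * M \<gamma> cone_exponent))
    \<longlongrightarrow> sqnorm_laguerre \<kappa> Y n m l) at_top"
    unfolding sqnorm_laguerre_eq_sum[OF l] c_def M_def \<alpha>_def[symmetric] N_def[symmetric]
    \<comment> \<open>Positivity of the limiting normalizing moment permits the limit of the
      quotient.\<close>
    using \<alpha> cone_exponent_nonneg ray_moment_exp_weight_pos[of cone_exponent]
    by (intro tendsto_divide tendsto_sum tendsto_mult tendsto_jacobi_coeff tendsto_ray_moment) auto
  show "\<forall>\<^sub>F \<gamma> in at_top. (\<Sum>i\<le>N. \<Sum>k\<le>N. c \<gamma> i / \<gamma> ^ i * (c \<gamma> k / \<gamma> ^ k) *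
        (\<gamma> powr (\<alpha> + real (i + k) + 1) * M \<gamma> (\<alpha> + real (i + k)))) /
      (\<gamma> powr (cone_exponent + 1) * M \<gamma> cone_exponent) =
      \<gamma> ^ (2 * m) * sqnorm_jacobi \<kappa> \<gamma> Y n m l"
    using eventually_ge_at_top[of 1]
  proof eventually_elim
    case (elim \<gamma>)
    have "c \<gamma> i / \<gamma> ^ i * (c \<gamma> k / \<gamma> ^ k) *
        (\<gamma> powr (\<alpha> + real (i + k) + 1) * M \<gamma> (\<alpha> + real (i + k))) =
        \<gamma> powr (cone_exponent + 1) * \<gamma> ^ (2 * m) * (c \<gamma> i * c \<gamma> k * M \<gamma> (\<alpha> + real (i + k)))" for i k
    proof -
      have "\<alpha> + real (i + k) + 1 = (cone_exponent + 1) + real (2 * m) + real i + real k"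
        by (simp add: \<alpha>_def)
      then have "\<gamma> powr (\<alpha> + real (i + k) + 1) =
          \<gamma> powr (cone_exponent + 1) * \<gamma> ^ (2 * m) * \<gamma> ^ i * \<gamma> ^ k"
        using elim by (simp only: powr_add powr_realpow)
      then show ?thesis using elim by simp
    qed
    then have "(\<Sum>i\<le>N. \<Sum>k\<le>N. c \<gamma> i / \<gamma> ^ i * (c \<gamma> k / \<gamma> ^ k) *
        (\<gamma> powr (\<alpha> + real (i + k) + 1) * M \<gamma> (\<alpha> + real (i + k)))) =
        \<gamma> powr (cone_exponent + 1) * (\<gamma> ^ (2 * m) *
          (\<Sum>i\<le>N. \<Sum>k\<le>N. c \<gamma> i * c \<gamma> k * M \<gamma> (\<alpha> + real (i + k))))"
      by (simp add: sum_distrib_left mult.assoc)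
    then show ?case
      using elim unfolding sqnorm_jacobi_eq_sum[OF l elim]
      by (simp add: c_def M_def \<alpha>_def N_def)
  qed
qed

text \<open>Homogeneity turns Y(x/\<gamma>) into \<gamma>^(-m) Y(x), so the prefactor cancels and
  only the one-variable limit remains.\<close>

lemma tendsto_cone_jacobi:
  assumes l: "1 \<le> l" "l \<le> h_dim CARD('d) m"
  shows "((\<lambda>\<gamma>. \<gamma> ^ m * cone_jacobi \<kappa> \<gamma> Y n m l (x /\<^sub>R \<gamma>, t / \<gamma>))
    \<longlongrightarrow> cone_laguerre \<kappa> Y n m l (x, t)) at_top"
proof (rule Lim_transform_eventually)
  let ?\<alpha> = "2 * real m + 2 * abs_kappa \<kappa> + real CARD('d) - 2"
  have "?\<alpha> > -1" using cone_exponent_nonneg by linarith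
  from tendsto_mult[OF tendsto_jacobi_laguerre[OF this, of "n - m" t] tendsto_const]
  show "((\<lambda>\<gamma>. jacobi (n - m) ?\<alpha> \<gamma> (1 - 2 * (t / \<gamma>)) * Y m l x)
      \<longlongrightarrow> cone_laguerre \<kappa> Y n m l (x, t)) at_top"
    by (simp add: cone_laguerre_def)
  show "\<forall>\<^sub>F \<gamma> in at_top. jacobi (n - m) ?\<alpha> \<gamma> (1 - 2 * (t / \<gamma>)) * Y m l x =
      \<gamma> ^ m * cone_jacobi \<kappa> \<gamma> Y n m l (x /\<^sub>R \<gamma>, t / \<gamma>)"
    using eventually_gt_at_top[of 0]
    by eventually_elim
      (simp add: cone_jacobi_def homogeneous_polys_scaleR[OF orthonormal_h_basisD(1)[OF l]]
        power_inverse)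
qed

text \<open>In each summand the factors \<gamma>^m of the two basis functions cancel the
  \<gamma>^(2m) of the norm, so the kernel needs no prefactor.\<close>

lemma tendsto_kernel_jacobi:
  "((\<lambda>\<gamma>. kernel_jacobi \<kappa> \<gamma> Y n (x /\<^sub>R \<gamma>, t / \<gamma>) (y /\<^sub>R \<gamma>, s / \<gamma>))
    \<longlongrightarrow> kernel_laguerre \<kappa> Y n (x, t) (y, s)) at_top"
  unfolding kernel_jacobi_def kernel_laguerre_def
proof (intro tendsto_sum)
  fix m l
  assume "l \<in> {1..h_dim CARD('d) m}"
  then have l: "1 \<le> l" "l \<le> h_dim CARD('d) m" by auto
  let ?J = "\<lambda>\<gamma> x t. cone_jacobi \<kappa> \<gamma> Y n m l (x /\<^sub>R \<gamma>, t / \<gamma>)"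
  show "((\<lambda>\<gamma>. ?J \<gamma> x t * ?J \<gamma> y s / sqnorm_jacobi \<kappa> \<gamma> Y n m l) \<longlongrightarrow>
      cone_laguerre \<kappa> Y n m l (x, t) * cone_laguerre \<kappa> Y n m l (y, s) /
      sqnorm_laguerre \<kappa> Y n m l) at_top"
  proof (rule Lim_transform_eventually)
    show "((\<lambda>\<gamma>. (\<gamma> ^ m * ?J \<gamma> x t) * (\<gamma> ^ m * ?J \<gamma> y s) /
        (\<gamma> ^ (2 * m) * sqnorm_jacobi \<kappa> \<gamma> Y n m l)) \<longlongrightarrow>
        cone_laguerre \<kappa> Y n m l (x, t) * cone_laguerre \<kappa> Y n m l (y, s) /
        sqnorm_laguerre \<kappa> Y n m l) at_top"
      by (intro tendsto_divide tendsto_mult[OF tendsto_cone_jacobi tendsto_cone_jacobi]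
          tendsto_sqnorm_jacobi sqnorm_laguerre_nonzero l)
    show "\<forall>\<^sub>F \<gamma> in at_top. (\<gamma> ^ m * ?J \<gamma> x t) * (\<gamma> ^ m * ?J \<gamma> y s) /
        (\<gamma> ^ (2 * m) * sqnorm_jacobi \<kappa> \<gamma> Y n m l) = ?J \<gamma> x t * ?J \<gamma> y s / sqnorm_jacobi \<kappa> \<gamma> Y n m l"
      using eventually_gt_at_top[of 0]
      by eventually_elim (simp add: mult_2 power_add)
  qed
qed

end

theorem proposition3p4:
  fixes \<kappa> :: "real ^ 'd"
    and Y :: "nat \<Rightarrow> nat \<Rightarrow> real ^ 'd \<Rightarrow> real"
    and n m l :: nat
  assumes "CARD('d) \<ge> 2"
    and "\<And>i. \<kappa> $ i \<ge> 0"
    and "\<And>k. orthonormal_h_basis \<kappa> k (Y k)"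
    and "m \<le> n"
    and "1 \<le> l" and "l \<le> h_dim CARD('d) m"
  shows "(\<forall>(x, t) \<in> cone_surface.
            ((\<lambda>\<gamma>. \<gamma> ^ m * cone_jacobi \<kappa> \<gamma> Y n m l (x /\<^sub>R \<gamma>, t / \<gamma>))
               \<longlongrightarrow> cone_laguerre \<kappa> Y n m l (x, t)) at_top) \<and>
         ((\<lambda>\<gamma>. \<gamma> ^ (2 * m) * sqnorm_jacobi \<kappa> \<gamma> Y n m l)
            \<longlongrightarrow> sqnorm_laguerre \<kappa> Y n m l) at_top \<and>
         (\<forall>(x, t) \<in> cone_surface. \<forall>(y, s) \<in> cone_surface.
            ((\<lambda>\<gamma>. kernel_jacobi \<kappa> \<gamma> Y n (x /\<^sub>R \<gamma>, t / \<gamma>) (y /\<^sub>R \<gamma>, s / \<gamma>))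
               \<longlongrightarrow> kernel_laguerre \<kappa> Y n (x, t) (y, s)) at_top)"
  using tendsto_cone_jacobi[OF assms(1-3,5,6)] tendsto_sqnorm_jacobi[OF assms(1-3,5,6)]
    tendsto_kernel_jacobi[OF assms(1-3)]
  by auto

end
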